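(* For integers $l\ge0$, $k\ge0$ let $H_{l,k}(x)=\sum_{n\ge l+1}\frac{p^{\,n+k-l}_{n,n+k;\le n+k}}{(n-1)!}x^n$. Then $H_{0,k}(x)=x[P(x)]^{k+1}$, and for every $l\ge1$ $$H_{l,k}(x)=H_{l-1,k}(x)-\frac{p^1_{l,l+k;\le l+k}}{(l-1)!}x^l+\frac{p_l}{l!}x^{l+1}[P(x)]^{k+1}.$$
   Context: Parking model: there are $m$ parking spaces in a line, numbered $1,\dots,m$. A preference set of length $n$ is a sequence $(a_1,\dots,a_n)$ of integers with $1\le a_i\le m$; cars $1,\dots,n$ arrive in order, car $i$ parks in the first unoccupied space numbered $\ge a_i$ if one exists, otherwise it fails to park. A parking function is a preference set in which all cars park. $p^r_{n,m;\le s}$ denotes the number of parking functions of length $n$ with $m$ spaces, all entries $\le s$, and $a_1=r$. $p_l=(l+1)^{l-1}$ is the number of parking functions of length $l$ with $l$ spaces. $P(x)=\sum_{n\ge0}\frac{(n+1)^{n-1}}{n!}x^n$. *)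

theory Defs
  imports "HOL-Computational_Algebra.Formal_Power_Series"
begin

definition available :: "nat \<Rightarrow> nat set \<Rightarrow> nat \<Rightarrow> nat set" where
  "available m S a = {j. a \<le> j \<and> j \<le> m \<and> j \<notin> S}"

text \<open>The set argument is the set of occupied spaces when the first car of the list arrives.\<close>

fun all_park :: "nat \<Rightarrow> nat set \<Rightarrow> nat list \<Rightarrow> bool" where
  "all_park m S [] = True"
| "all_park m S (a # as) =
     (available m S a \<noteq> {} \<and> all_park m (insert (Min (available m S a)) S) as)"

definition parking_functions :: "nat \<Rightarrow> nat \<Rightarrow> nat list set" where
  "parking_functions n m =
     {as. length as = n \<and> set as \<subseteq> {1..m} \<and> all_park m {} as}"

text \<open>The number \<open>p\<^sup>r\<^bsub>n,m;\<le>s\<^esub>\<close> is \<open>pf_count r n m s\<close>.\<close>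

definition pf_count :: "nat \<Rightarrow> nat \<Rightarrow> nat \<Rightarrow> nat \<Rightarrow> nat" where
  "pf_count r n m s =
     card {as \<in> parking_functions n m. (\<forall>a\<in>set as. a \<le> s) \<and> as \<noteq> [] \<and> hd as = r}"

definition pf_number :: "nat \<Rightarrow> nat" where
  "pf_number l = card (parking_functions l l)"

text \<open>For \<open>n = 0\<close> the truncated exponent still gives the intended value \<open>1\<close>.\<close>

definition P_series :: "rat fps" where
  "P_series = Abs_fps (\<lambda>n. of_nat ((n + 1) ^ (n - 1)) / fact n)"

definition H_series :: "nat \<Rightarrow> nat \<Rightarrow> rat fps" where
  "H_series l k = Abs_fps (\<lambda>n.
     if n \<ge> l + 1 then of_nat (pf_count (n + k - l) n (n + k) (n + k)) / fact (n - 1) else 0)"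

end

theory Submission
  imports Defs "HOL-Computational_Algebra.Polynomial"
begin

text \<open>
  A preference list parks iff, for every \<open>s\<close>, at most \<open>m + 1 - s\<close> cars prefer a space \<open>\<ge> s\<close>. Deleting the
  cars that prefer space 1 turns this into a recurrence whose solution is \<open>(m + 1 - n) (m + 1)\<^sup>n\<^sup>-\<^sup>1\<close>
  parking functions of \<open>n\<close> cars on \<open>m\<close> spaces, and Abel's binomial theorem identifies these numbers, for
  \<open>m = n + k\<close>, with the coefficients of \<open>P\<^sup>k\<^sup>+\<^sup>1\<close>.

  Raising the first preference from \<open>m - l\<close> to \<open>m - l + 1\<close> destroys the parking property exactly when
  \<open>l\<close> of the other cars prefer the last \<open>l\<close> spaces. Such a list is a shuffle of a parking function on
  these \<open>l\<close> spaces with one on the first \<open>m - l - 1\<close> spaces, which is the coefficient of the product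
  in the recurrence for \<open>H\<close>.
\<close>

unbundle fps_syntax

section \<open>Abel's binomial theorem and powers of \<open>P\<close>\<close>

text \<open>An \<open>n\<close>-th finite difference annihilates powers of exponent below
  \<open>n\<close>: the sum is \<open>fact j\<close> times the coefficient of degree
  \<open>j\<close> in \<open>fps_exp x * (fps_exp 1 - 1) ^ n\<close>, a series without terms below
  degree \<open>n\<close>.\<close>

lemma alternating_binomial_sum_power_eq_0:
  fixes x :: "'a::field_char_0"
  assumes "j < n"
  shows "(\<Sum>i\<le>n. of_nat (n choose i) * (-1) ^ (n - i) * (x + of_nat i) ^ j) = 0"
proof -
  have "fps_exp x * (fps_exp 1 - 1) ^ n
      = fps_exp x * (\<Sum>i\<le>n. of_nat (n choose i) * fps_exp 1 ^ i * (-1) ^ (n - i))"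
    using binomial_ring[of "fps_exp (1::'a)" "-1" n] by simp
  also have "\<dots> = (\<Sum>i\<le>n. fps_const (of_nat (n choose i) * (-1) ^ (n - i)) * fps_exp (x + of_nat i))"
    unfolding sum_distrib_left
    by (intro sum.cong refl)
      (simp add: fps_exp_power_mult fps_exp_add_mult mult_ac fps_of_nat[symmetric]
        flip: fps_const_mult fps_const_power fps_const_neg fps_const_1_eq_1)
  finally have "(fps_exp x * (fps_exp 1 - 1) ^ n) $ j
      = (\<Sum>i\<le>n. of_nat (n choose i) * (-1) ^ (n - i) * (x + of_nat i) ^ j) / fact j"
    by (simp add: fps_sum_nth sum_divide_distrib)
  moreover have "(fps_exp x * (fps_exp 1 - 1) ^ n) $ j = 0"
    unfolding fps_mult_nth
    using assms by (intro sum.neutral ballI) (simp add: startsby_zero_power_prefix)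
  ultimately show ?thesis by simp
qed

lemma pderiv_sum: "pderiv (sum f A) = (\<Sum>i\<in>A. pderiv (f i))"
  using higher_pderiv_sum[of 1 f A] by simp

text \<open>This is \<open>x (x + n)\<^sup>n\<^sup>-\<^sup>1\<close>, in a form that takes the intended value \<open>1\<close> also at \<open>n = 0\<close>.\<close>

definition abel_coeff :: "'a::field_char_0 \<Rightarrow> nat \<Rightarrow> 'a" where
  "abel_coeff x n = (x + of_nat n) ^ n - of_nat n * (x + of_nat n) ^ (n - 1)"

text \<open>Both sides have the same derivative in \<open>y\<close> by the induction hypothesis at \<open>y + 1\<close>, and at
  \<open>y = - x - n\<close> the left-hand side is an \<open>n\<close>-th finite difference of a polynomial of degree \<open>n - 1\<close>.\<close>

lemma abel_binomial:
  fixes x y :: "'a::field_char_0"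
  shows "(\<Sum>i\<le>n. of_nat (n choose i) * abel_coeff x i * (y + of_nat (n - i)) ^ (n - i))
    = (x + y + of_nat n) ^ n"
proof (induction n arbitrary: y)
  case 0
  show ?case by (simp add: abel_coeff_def)
next
  case (Suc n)
  \<comment> \<open>The difference of the two sides as a polynomial in \<open>y\<close>. It is shown
    to be constant and then to have a root.\<close>
  define g where "g = (\<Sum>i\<le>Suc n. smult (of_nat (Suc n choose i) * abel_coeff x i)
      ([:of_nat (Suc n - i), 1:] ^ (Suc n - i))) - [:x + of_nat (Suc n), 1:] ^ Suc n"
  have poly_g: "poly g y = (\<Sum>i\<le>Suc n. of_nat (Suc n choose i) * abel_coeff x i
      * (y + of_nat (Suc n - i)) ^ (Suc n - i)) - (x + y + of_nat (Suc n)) ^ Suc n" for y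
    unfolding g_def by (simp add: poly_sum add_ac del: sum.atMost_Suc power_Suc of_nat_Suc)
  have choose_shift: "of_nat (Suc n - i) * of_nat (Suc n choose i) = (of_nat (Suc n) * of_nat (n choose i) :: 'a)"
    if "i \<le> n" for i
    using binomial_absorb_comp[of "Suc n" i] by (metis diff_Suc_1 of_nat_mult)
  have "poly (pderiv g) y = 0" for y
  proof -
    have "poly (pderiv g) y = (\<Sum>i\<le>Suc n. of_nat (Suc n choose i) * abel_coeff x i *
        (of_nat (Suc n - i) * (y + of_nat (Suc n - i)) ^ (Suc n - i - 1)))
        - of_nat (Suc n) * (x + y + of_nat (Suc n)) ^ n"
      unfolding g_def
      by (simp add: pderiv_diff pderiv_sum pderiv_smult pderiv_power pderiv_pCons poly_sum add_ac mult_ac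
          del: sum.atMost_Suc power_Suc of_nat_Suc)
    \<comment> \<open>The top term vanishes because of its factor
      \<open>of_nat (Suc n - i)\<close>.\<close>
    also have "(\<Sum>i\<le>Suc n. of_nat (Suc n choose i) * abel_coeff x i *
        (of_nat (Suc n - i) * (y + of_nat (Suc n - i)) ^ (Suc n - i - 1)))
      = (\<Sum>i\<le>n. of_nat (Suc n choose i) * abel_coeff x i *
        (of_nat (Suc n - i) * (y + of_nat (Suc n - i)) ^ (Suc n - i - 1)))"
      by simp
    also have "\<dots> = (\<Sum>i\<le>n. of_nat (Suc n) * (of_nat (n choose i) * abel_coeff x i *
        ((y + 1) + of_nat (n - i)) ^ (n - i)))"
    proof (intro sum.cong refl)
      fix i assume "i \<in> {..n}"
      then have "i \<le> n" by simp
      then have "Suc n - i - 1 = n - i" and "y + of_nat (Suc n - i) = (y + 1) + of_nat (n - i)"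
        by (simp_all add: Suc_diff_le)
      then have "of_nat (Suc n choose i) * abel_coeff x i *
          (of_nat (Suc n - i) * (y + of_nat (Suc n - i)) ^ (Suc n - i - 1))
        = of_nat (Suc n - i) * of_nat (Suc n choose i) * (abel_coeff x i * ((y + 1) + of_nat (n - i)) ^ (n - i))"
        by (simp only: mult_ac)
      then show "of_nat (Suc n choose i) * abel_coeff x i *
          (of_nat (Suc n - i) * (y + of_nat (Suc n - i)) ^ (Suc n - i - 1))
        = of_nat (Suc n) * (of_nat (n choose i) * abel_coeff x i * ((y + 1) + of_nat (n - i)) ^ (n - i))"
        unfolding choose_shift[OF \<open>i \<le> n\<close>] by (simp only: mult_ac)
    qed
    also have "\<dots> = of_nat (Suc n) * (x + (y + 1) + of_nat n) ^ n"
      unfolding sum_distrib_left[symmetric] Suc.IH ..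
    finally show ?thesis by (simp add: add_ac)
  qed
  then have "pderiv g = 0"
    by (metis poly_all_0_iff_0)
  then obtain c where c: "g = [:c:]"
    by (metis pderiv_eq_0_iff degree_eq_zeroE)
  have "poly g (- x - of_nat (Suc n)) = 0"
  proof -
    \<comment> \<open>At this point the shifted base becomes \<open>- (x + of_nat i)\<close>. Its
      power merges with the one inside \<open>abel_coeff x i\<close> to the exponent
      \<open>n\<close>, the same for all \<open>i\<close>, which leaves a finite difference.\<close>
    have "of_nat (Suc n choose i) * abel_coeff x i * (- x - of_nat (Suc n) + of_nat (Suc n - i)) ^ (Suc n - i)
        = x * (of_nat (Suc n choose i) * (-1) ^ (Suc n - i) * (x + of_nat i) ^ n)" if "i \<le> Suc n" for i
    proof -
      have "- x - of_nat (Suc n) + of_nat (Suc n - i) = - (x + of_nat i)"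
        using that by (simp add: of_nat_diff)
      moreover have "abel_coeff x i * (x + of_nat i) ^ (Suc n - i) = x * (x + of_nat i) ^ n"
      proof (cases i)
        case 0
        then show ?thesis by (simp add: abel_coeff_def)
      next
        case (Suc j)
        have "abel_coeff x i = x * (x + of_nat i) ^ j"
          by (simp add: abel_coeff_def Suc algebra_simps)
        moreover have "n = j + (Suc n - i)" using Suc that by simp
        ultimately show ?thesis by (metis mult.assoc power_add)
      qed
      ultimately show ?thesis
        by (subst \<open>_ = - (x + of_nat i)\<close>, subst power_minus) (simp add: mult_ac)
    qed
    then have "poly g (- x - of_nat (Suc n))
        = x * (\<Sum>i\<le>Suc n. of_nat (Suc n choose i) * (-1) ^ (Suc n - i) * (x + of_nat i) ^ n)"
      unfolding poly_g sum_distrib_left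
      by (subst sum.cong[OF refl]) (auto simp del: sum.atMost_Suc of_nat_Suc binomial_Suc_Suc)
    then show ?thesis
      by (simp only: alternating_binomial_sum_power_eq_0[OF lessI] mult_zero_right)
  qed
  then have "g = 0" by (simp add: c)
  then show ?case using poly_g[of y] by (simp del: sum.atMost_Suc power_Suc of_nat_Suc)
qed

section \<open>Abel's theorem as an exponential law for power series\<close>

definition abel_fps :: "'a::field_char_0 \<Rightarrow> 'a fps" where
  "abel_fps x = Abs_fps (\<lambda>n. abel_coeff x n / fact n)"

text \<open>With the tree function T, determined by T = X exp(T), this is exp(x T) / (1 - T), while
  \<open>abel_fps x\<close> is exp(x T).\<close>

definition power_fps :: "'a::field_char_0 \<Rightarrow> 'a fps" where
  "power_fps x = Abs_fps (\<lambda>n. (x + of_nat n) ^ n / fact n)"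

text \<open>Abel's binomial theorem divided by \<open>fact n\<close>, read as a convolution of
  coefficients.\<close>

lemma abel_fps_mult_power_fps: "abel_fps x * power_fps y = power_fps (x + y)"
proof (rule fps_ext)
  fix n
  have "(abel_fps x * power_fps y) $ n
      = (\<Sum>i\<le>n. of_nat (n choose i) * abel_coeff x i * (y + of_nat (n - i)) ^ (n - i)) / fact n"
    unfolding fps_mult_nth sum_divide_distrib atLeast0AtMost
    by (intro sum.cong refl) (simp add: abel_fps_def power_fps_def binomial_fact field_simps)
  then show "(abel_fps x * power_fps y) $ n = power_fps (x + y) $ n"
    unfolding abel_binomial by (simp add: power_fps_def)
qed

lemma abel_fps_eq: "abel_fps x = power_fps x - fps_X * power_fps (x + 1)"
proof (rule fps_ext)
  fix n
  show "abel_fps x $ n = (power_fps x - fps_X * power_fps (x + 1)) $ n"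
  proof (cases n)
    case (Suc j)
    have "of_nat (Suc j) / fact (Suc j) = (1 / fact j :: 'a)" by (simp add: field_simps del: of_nat_Suc)
    then have "of_nat (Suc j) * (x + of_nat (Suc j)) ^ j / fact (Suc j) = (x + of_nat (Suc j)) ^ j / fact j"
      by (metis mult.commute times_divide_eq_right mult.right_neutral)
    then show ?thesis
      by (simp add: Suc abel_fps_def abel_coeff_def power_fps_def diff_divide_distrib add_ac
          del: of_nat_Suc fact_Suc power_Suc) (simp add: add_ac)
  qed (simp add: abel_fps_def abel_coeff_def power_fps_def)
qed

text \<open>Writing the second factor through \<open>power_fps\<close> leaves two mixed products,
  and both are covered by Abel's theorem.\<close>

lemma abel_fps_add: "abel_fps (x + y) = abel_fps x * abel_fps y"
proof -
  have "abel_fps x * abel_fps y = abel_fps x * power_fps y - fps_X * (abel_fps x * power_fps (y + 1))"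
    by (simp add: abel_fps_eq[of y] algebra_simps)
  then show ?thesis
    by (simp add: abel_fps_mult_power_fps abel_fps_eq[of "x + y"] add.assoc)
qed

lemma abel_fps_0: "abel_fps 0 = 1"
proof (rule fps_ext)
  fix n
  show "abel_fps 0 $ n = (1 :: 'a fps) $ n"
    by (cases n) (simp_all add: abel_fps_def abel_coeff_def)
qed

lemma P_series_eq_abel_fps: "P_series = abel_fps 1"
proof (rule fps_ext)
  fix n
  show "P_series $ n = abel_fps 1 $ n"
    by (cases n) (simp_all add: abel_fps_def abel_coeff_def P_series_def algebra_simps)
qed

lemma P_series_power: "P_series ^ k = abel_fps (of_nat k)"
  by (induction k) (simp_all add: abel_fps_0 abel_fps_add P_series_eq_abel_fps)

section \<open>Counting parking functions\<close>

lemma available_finite: "finite (available m S a)"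
  by (rule finite_subset[of _ "{..m}"]) (auto simp: available_def)

text \<open>The spaces from \<open>s\<close> on must hold those cars already there and all later
  cars preferring them. The occupied set \<open>S\<close> is arbitrary so that the induction can
  follow the cars one by one. The criterion is written additively to avoid truncated
  subtraction.\<close>

lemma all_park_iff:
  assumes "set as \<subseteq> {1..m}"
  shows "all_park m S as \<longleftrightarrow>
    (\<forall>s\<in>{1..m}. length (filter ((\<le>) s) as) + card (S \<inter> {s..m}) + s \<le> Suc m)"
  using assms
proof (induction as arbitrary: S)
  case Nil
  have "card (S \<inter> {s..m}) \<le> Suc m - s" for s
    using card_mono[of "{s..m}" "S \<inter> {s..m}"] by simp
  then have "card (S \<inter> {s..m}) + s \<le> Suc m" if "s \<le> m" for s
    using that by (metis le_SucI le_diff_conv2)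
  then show ?case by simp
next
  case (Cons a as)
  have a: "1 \<le> a" "a \<le> m" using Cons.prems by auto
  define cnt where "cnt s = length (filter ((\<le>) s) as)" for s
  have cnt_mono: "cnt t \<le> cnt s" if "s \<le> t" for s t
  proof -
    have "filter ((\<le>) t) as = filter ((\<le>) t) (filter ((\<le>) s) as)"
      unfolding filter_filter by (rule filter_cong) (use that in auto)
    then show ?thesis unfolding cnt_def by (metis length_filter_le)
  qed
  let ?C = "\<lambda>S. \<forall>s\<in>{1..m}. cnt s + card (S \<inter> {s..m}) + s \<le> Suc m"
  let ?L = "\<forall>s\<in>{1..m}. cnt s + (if s \<le> a then 1 else 0) + card (S \<inter> {s..m}) + s \<le> Suc m"
  have IH: "all_park m T as \<longleftrightarrow> ?C T" for T
    unfolding cnt_def using Cons.prems by (intro Cons.IH) auto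
  have L: "(\<forall>s\<in>{1..m}. length (filter ((\<le>) s) (a # as)) + card (S \<inter> {s..m}) + s \<le> Suc m) \<longleftrightarrow> ?L"
    by (intro ball_cong refl) (simp add: cnt_def)
  show ?case
  proof (cases "available m S a = {}")
    case True
    \<comment> \<open>All spaces from \<open>a\<close> on are taken, so the arriving car violates
      the condition at \<open>s = a\<close>.\<close>
    then have "{a..m} \<subseteq> S" by (auto simp: available_def)
    then have "S \<inter> {a..m} = {a..m}" by auto
    then have "card (S \<inter> {a..m}) = Suc m - a" by simp
    then have "\<not> ?L" using a by (intro notI, drule_tac bspec[of _ _ a]) auto
    then show ?thesis using True L by simp
  next
    case False
    define b where "b = Min (available m S a)"
    have "b \<in> available m S a" unfolding b_def using False available_finite by (intro Min_in) auto
    then have b: "a \<le> b" "b \<le> m" "b \<notin> S" by (auto simp: available_def)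
    have below: "j \<in> S" if "a \<le> j" "j < b" for j
    proof (rule ccontr)
      assume "j \<notin> S"
      then have "j \<in> available m S a" using that b by (auto simp: available_def)
      then have "b \<le> j" unfolding b_def using available_finite by (intro Min_le) auto
      then show False using that by simp
    qed
    have card_insert: "card (insert b S \<inter> {s..m}) = card (S \<inter> {s..m}) + (if s \<le> b then 1 else 0)" for s
      using b by (auto simp: Int_insert_left)
    \<comment> \<open>Before parking, the car counts for \<open>s \<le> a\<close>; afterwards its
      space counts for \<open>s \<le> b\<close>. The two conditions therefore differ only for
      \<open>a < s \<le> b\<close>.\<close>
    have "?L \<longleftrightarrow> ?C (insert b S)"
    proof
      assume ?L
      show "?C (insert b S)"
      proof
        fix s assume s: "s \<in> {1..m}"
        show "cnt s + card (insert b S \<inter> {s..m}) + s \<le> Suc m"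
        proof (cases "a < s \<and> s \<le> b")
          case True
          have disjoint: "{a..<s} \<inter> (S \<inter> {s..m}) = {}" by auto
          \<comment> \<open>The spaces from \<open>a\<close> up to \<open>s - 1\<close> are full, so
            moving the threshold from \<open>a\<close> to \<open>s\<close> lowers the occupied count
            by exactly \<open>s - a\<close>, and the condition at \<open>a\<close> gives the one at
            \<open>s\<close>.\<close>
          have "S \<inter> {a..m} = {a..<s} \<union> (S \<inter> {s..m})"
            using below True b by (auto intro: below)
          then have "card (S \<inter> {a..m}) = (s - a) + card (S \<inter> {s..m})"
            by (metis card_Un_disjoint card_atLeastLessThan finite_atLeastLessThan finite_Int
                finite_atLeastAtMost disjoint)
          moreover have "cnt a + 1 + card (S \<inter> {a..m}) + a \<le> Suc m"
            using \<open>?L\<close>[rule_format, of a] a by simp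
          moreover have "cnt s \<le> cnt a" using True by (intro cnt_mono) simp
          ultimately show ?thesis using True by (simp add: card_insert)
        next
          case False
          then show ?thesis using \<open>?L\<close>[rule_format, OF s] b by (auto simp: card_insert split: if_splits)
        qed
      qed
    next
      assume R: "?C (insert b S)"
      show ?L
      proof
        fix s assume s: "s \<in> {1..m}"
        show "cnt s + (if s \<le> a then 1 else 0) + card (S \<inter> {s..m}) + s \<le> Suc m"
          using R[rule_format, OF s] b by (auto simp: card_insert split: if_splits)
      qed
    qed
    then show ?thesis using False L IH by (simp add: b_def)
  qed
qed

text \<open>Parking functions for the spaces \<open>c + 1, \<dots>, c + m\<close>.\<close>

definition shifted_pf :: "nat \<Rightarrow> nat \<Rightarrow> nat \<Rightarrow> nat list set" where
  "shifted_pf c n m = {as. length as = n \<and> set as \<subseteq> {c<..c + m} \<and>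
     (\<forall>s\<in>{c<..c + m}. length (filter ((\<le>) s) as) + s \<le> Suc (c + m))}"

lemma parking_functions_eq: "parking_functions n m = shifted_pf 0 n m"
proof -
  have "{0<..m} = {1..m}" by auto
  then show ?thesis
    unfolding parking_functions_def shifted_pf_def by (auto simp: all_park_iff)
qed

lemma finite_shifted_pf: "finite (shifted_pf c n m)"
  by (rule finite_subset[OF _ finite_lists_length_eq[of "{c<..c + m}" n]])
    (auto simp: shifted_pf_def)

lemma shifted_pf_eq_image: "shifted_pf c n m = map ((+) c) ` shifted_pf 0 n m"
proof (intro equalityI subsetI)
  fix as assume as: "as \<in> shifted_pf c n m"
  define bs where "bs = map (\<lambda>a. a - c) as"
  have map_bs: "as = map ((+) c) bs"
    using as by (auto simp: bs_def shifted_pf_def o_def intro!: map_idI[symmetric])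
  have "length (filter ((\<le>) s) bs) + s \<le> Suc m" if "0 < s" "s \<le> m" for s
  proof -
    have "length (filter ((\<le>) (c + s)) as) + (c + s) \<le> Suc (c + m)"
      using as that by (auto simp: shifted_pf_def)
    then show ?thesis by (simp add: map_bs filter_map o_def)
  qed
  moreover have "length bs = n" "set bs \<subseteq> {0<..m}"
    using as by (fastforce simp: bs_def shifted_pf_def)+
  ultimately have "bs \<in> shifted_pf 0 n m" by (auto simp: shifted_pf_def)
  with map_bs show "as \<in> map ((+) c) ` shifted_pf 0 n m" by blast
next
  fix as assume "as \<in> map ((+) c) ` shifted_pf 0 n m"
  then obtain bs where bs: "bs \<in> shifted_pf 0 n m" and as: "as = map ((+) c) bs" by blast
  have "length (filter ((\<le>) s) as) + s \<le> Suc (c + m)" if "c < s" "s \<le> c + m" for s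
  proof -
    have "s - c \<in> {0<..0 + m}" using that by auto
    then have "length (filter ((\<le>) (s - c)) bs) + (s - c) \<le> Suc m"
      using bs unfolding shifted_pf_def by fastforce
    moreover have "filter ((\<le>) s) as = map ((+) c) (filter ((\<le>) (s - c)) bs)"
      unfolding as filter_map o_def
      by (intro arg_cong[where f = "map ((+) c)"] filter_cong refl) (use that in auto)
    ultimately show ?thesis using that by simp
  qed
  then show "as \<in> shifted_pf c n m" using bs by (auto simp: shifted_pf_def as)
qed

lemma card_shifted_pf: "card (shifted_pf c n m) = card (parking_functions n m)"
  unfolding shifted_pf_eq_image[of c] parking_functions_eq
  by (rule card_image) (simp add: inj_on_def inj_map_eq_map)

text \<open>These lists are the disjoint union of the sets \<open>shuffles xs ys\<close>. Since
  \<open>xs\<close> and \<open>ys\<close> have no common entry, each shuffle is determined by the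
  positions of \<open>xs\<close>.\<close>

lemma card_filter_partition:
  assumes "finite L" "finite R"
    and L: "\<And>xs. xs \<in> L \<Longrightarrow> length xs = a \<and> (\<forall>x\<in>set xs. P x)"
    and R: "\<And>ys. ys \<in> R \<Longrightarrow> length ys = b \<and> (\<forall>y\<in>set ys. \<not> P y)"
  shows "finite {zs. filter P zs \<in> L \<and> filter (\<lambda>x. \<not> P x) zs \<in> R}" (is "finite ?Z")
    and "card {zs. filter P zs \<in> L \<and> filter (\<lambda>x. \<not> P x) zs \<in> R}
      = ((a + b) choose a) * card L * card R"
proof -
  have shuffles: "shuffles xs ys = {zs. filter P zs = xs \<and> filter (\<lambda>x. \<not> P x) zs = ys}"
    if "xs \<in> L" "ys \<in> R" for xs ys
  proof -
    have "shuffles xs ys = partition P -` {(xs, ys)}"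
      using L[OF that(1)] R[OF that(2)] by (intro inv_image_partition[symmetric]) auto
    then show ?thesis by (simp add: vimage_def o_def)
  qed
  have Z: "?Z = (\<Union>(xs, ys)\<in>L \<times> R. shuffles xs ys)"
    using shuffles by auto
  show "finite ?Z" unfolding Z using assms(1,2) by auto
  have "card ?Z = (\<Sum>(xs, ys)\<in>L \<times> R. card (shuffles xs ys))"
    unfolding Z
  proof (subst card_UN_disjoint)
    show "\<forall>p\<in>L \<times> R. \<forall>q\<in>L \<times> R. p \<noteq> q \<longrightarrow>
        (case p of (xs, ys) \<Rightarrow> shuffles xs ys) \<inter> (case q of (xs, ys) \<Rightarrow> shuffles xs ys) = {}"
      using shuffles by fastforce
  qed (use assms(1,2) in \<open>auto simp: case_prod_unfold\<close>)
  also have "\<dots> = (\<Sum>(xs, ys)\<in>L \<times> R. (a + b) choose a)"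
  proof (intro sum.cong refl, clarify)
    fix xs ys assume "xs \<in> L" "ys \<in> R"
    moreover from this have "set xs \<inter> set ys = {}" using L R by blast
    ultimately show "card (shuffles xs ys) = (a + b) choose a"
      using L R by (simp add: card_disjoint_shuffles)
  qed
  finally show "card ?Z = ((a + b) choose a) * card L * card R"
    by (simp add: card_cartesian_product)
qed

lemma length_filter_split:
  "length zs = length (filter P zs) + length (filter (\<lambda>x. \<not> P x) zs)"
  using sum_length_filter_compl[of P zs] by simp

lemma filter_ge_filter_gt:
  fixes s t :: nat
  assumes "t < s"
  shows "filter ((\<le>) s) (filter (\<lambda>x. \<not> x \<le> t) zs) = filter ((\<le>) s) zs"
  unfolding filter_filter by (rule filter_cong) (use assms in auto)

lemma length_filter_ge_split:
  fixes s t :: nat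
  assumes "s \<le> t"
  shows "length (filter ((\<le>) s) zs)
    = length (filter ((\<le>) s) (filter (\<lambda>x. x \<le> t) zs)) + length (filter (\<lambda>x. \<not> x \<le> t) zs)"
proof -
  have "filter (\<lambda>x. x \<le> t) (filter ((\<le>) s) zs) = filter ((\<le>) s) (filter (\<lambda>x. x \<le> t) zs)"
    unfolding filter_filter by (intro filter_cong) auto
  moreover have "filter (\<lambda>x. \<not> x \<le> t) (filter ((\<le>) s) zs) = filter (\<lambda>x. \<not> x \<le> t) zs"
    unfolding filter_filter by (intro filter_cong) (use assms in auto)
  ultimately show ?thesis
    using length_filter_split[of "filter ((\<le>) s) zs" "\<lambda>x. x \<le> t"] by simp
qed

text \<open>Here \<open>j\<close> counts the cars not preferring space 1. For thresholds above 1
  only these matter, and they form a parking function on the remaining \<open>m\<close> spaces. The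
  threshold 1 merely requires \<open>n \<le> Suc m\<close>.\<close>

lemma card_parking_functions_Suc:
  assumes "n \<le> Suc m"
  shows "card (parking_functions n (Suc m)) = (\<Sum>j\<le>n. (n choose j) * card (parking_functions j m))"
proof -
  let ?Z = "\<lambda>j. {zs. filter (\<lambda>x. x \<le> 1) zs \<in> {replicate (n - j) 1} \<and>
    filter (\<lambda>x. \<not> x \<le> 1) zs \<in> shifted_pf 1 j m}"
  have Z: "finite (?Z j)" "card (?Z j) = (n choose j) * card (parking_functions j m)" if "j \<le> n" for j
  proof -
    have lo: "length xs = n - j \<and> (\<forall>x\<in>set xs. x \<le> 1)" if "xs \<in> {replicate (n - j) 1}" for xs :: "nat list"
      using that by simp
    have hi: "length ys = j \<and> (\<forall>y\<in>set ys. \<not> y \<le> 1)" if "ys \<in> shifted_pf 1 j m" for ys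
      using that by (auto simp: shifted_pf_def)
    have fin: "finite {replicate (n - j) (1::nat)}" by simp
    show "finite (?Z j)"
      by (rule card_filter_partition(1)[OF fin finite_shifted_pf lo hi])
    show "card (?Z j) = (n choose j) * card (parking_functions j m)"
      using card_filter_partition(2)[OF fin finite_shifted_pf lo hi] that
        binomial_symmetric[OF that] by (simp add: card_shifted_pf)
  qed
  have "shifted_pf 0 n (Suc m) = (\<Union>j\<in>{..n}. ?Z j)"
  proof (intro equalityI subsetI)
    fix zs assume zs: "zs \<in> shifted_pf 0 n (Suc m)"
    define j where "j = length (filter (\<lambda>x. \<not> x \<le> 1) zs)"
    have len: "length zs = n" "set zs \<subseteq> {0<..Suc m}" using zs by (auto simp: shifted_pf_def)
    then have n: "n = length (filter (\<lambda>x. x \<le> 1) zs) + j"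
      unfolding j_def using length_filter_split by metis
    have "filter (\<lambda>x. x \<le> 1) zs = replicate (n - j) 1"
      by (rule replicate_eqI) (use n len in auto)
    moreover have "filter (\<lambda>x. \<not> x \<le> 1) zs \<in> shifted_pf 1 j m"
    proof -
      have "length (filter ((\<le>) s) (filter (\<lambda>x. \<not> x \<le> 1) zs)) + s \<le> Suc (1 + m)"
        if "1 < s" "s \<le> 1 + m" for s
      proof -
        have "s \<in> {0<..0 + Suc m}" using that by simp
        then show ?thesis using zs unfolding shifted_pf_def filter_ge_filter_gt[OF that(1)] by fastforce
      qed
      then show ?thesis using len by (auto simp: shifted_pf_def j_def)
    qed
    moreover have "j \<in> {..n}" using n by simp
    ultimately show "zs \<in> (\<Union>j\<in>{..n}. ?Z j)" by blast
  next
    fix zs assume "zs \<in> (\<Union>j\<in>{..n}. ?Z j)"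
    then obtain j where j: "j \<le> n" and lo: "filter (\<lambda>x. x \<le> 1) zs = replicate (n - j) 1"
      and hi: "filter (\<lambda>x. \<not> x \<le> 1) zs \<in> shifted_pf 1 j m" by auto
    have len: "length zs = n"
      using length_filter_split[of zs "\<lambda>x. x \<le> 1"] lo hi j by (simp add: shifted_pf_def)
    have "x \<in> {0<..Suc m}" if "x \<in> set zs" for x
    proof (cases "x \<le> 1")
      case True
      then have "x \<in> set (filter (\<lambda>x. x \<le> 1) zs)" using that by simp
      then show ?thesis unfolding lo by auto
    next
      case False
      then have "x \<in> set (filter (\<lambda>x. \<not> x \<le> 1) zs)" using that by simp
      then show ?thesis using hi by (auto simp: shifted_pf_def)
    qed
    moreover have "length (filter ((\<le>) s) zs) + s \<le> Suc (Suc m)" if s: "0 < s" "s \<le> Suc m" for s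
    proof (cases "s = 1")
      case True
      then show ?thesis using length_filter_le[of "(\<le>) s" zs] len assms by linarith
    next
      case False
      then have "1 < s" using s by simp
      moreover have "s \<in> {1<..1 + m}" using s False by simp
      ultimately show ?thesis using hi filter_ge_filter_gt[of 1 s zs] unfolding shifted_pf_def by fastforce
    qed
    ultimately show "zs \<in> shifted_pf 0 n (Suc m)" using len by (auto simp: shifted_pf_def)
  qed
  then have "card (parking_functions n (Suc m)) = card (\<Union>j\<in>{..n}. ?Z j)"
    by (simp add: parking_functions_eq)
  also have "\<dots> = (\<Sum>j\<le>n. card (?Z j))"
  proof (rule card_UN_disjoint)
    show "\<forall>i\<in>{..n}. \<forall>j\<in>{..n}. i \<noteq> j \<longrightarrow> ?Z i \<inter> ?Z j = {}"
      by (auto simp: shifted_pf_def)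
  qed (use Z in auto)
  also have "\<dots> = (\<Sum>j\<le>n. (n choose j) * card (parking_functions j m))"
    using Z by (intro sum.cong) auto
  finally show ?thesis .
qed

text \<open>The boundary case of the closed form: the recurrence for \<open>Suc m\<close> spaces
  reaches \<open>j = Suc m\<close> cars on \<open>m\<close> spaces.\<close>

lemma card_parking_functions_too_many: "card (parking_functions (Suc m) m) = 0"
proof (cases m)
  case 0
  then show ?thesis by (auto simp: parking_functions_eq shifted_pf_def)
next
  case (Suc k)
  have False if "as \<in> shifted_pf 0 (Suc m) m" for as
  proof -
    have "filter ((\<le>) 1) as = as" using that by (auto simp: shifted_pf_def filter_id_conv)
    moreover have "1 \<in> {0<..0 + m}" using Suc by simp
    then have "length (filter ((\<le>) 1) as) + 1 \<le> Suc m"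
      using that unfolding shifted_pf_def by fastforce
    ultimately show False using that by (simp add: shifted_pf_def)
  qed
  then have "shifted_pf 0 (Suc m) m = {}" by blast
  then show ?thesis by (simp add: parking_functions_eq)
qed

text \<open>The derivative in \<open>x\<close> of the binomial expansion of
  \<open>(x + 1) ^ n\<close>. Truncated exponents occur only next to a factor 0.\<close>

lemma binomial_derivative_sum:
  fixes x :: "'a::comm_ring_1"
  shows "(\<Sum>j\<le>n. of_nat (n choose j) * of_nat j * x ^ (j - 1)) = of_nat n * (x + 1) ^ (n - 1)"
proof (cases n)
  case (Suc k)
  have absorb: "of_nat (Suc k choose Suc j) * of_nat (Suc j) = (of_nat (Suc k) * of_nat (k choose j) :: 'a)" for j
    using Suc_times_binomial_eq[of k j] by (metis of_nat_mult)
  have "(\<Sum>j\<le>n. of_nat (n choose j) * of_nat j * x ^ (j - 1))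
      = (\<Sum>j\<le>k. of_nat (Suc k choose Suc j) * of_nat (Suc j) * x ^ j)"
    unfolding Suc by (subst sum.atMost_Suc_shift) simp
  also have "\<dots> = of_nat (Suc k) * (x + 1) ^ k"
    unfolding absorb binomial_ring sum_distrib_left by (simp add: mult_ac)
  finally show ?thesis by (simp add: Suc)
qed simp

text \<open>Induction on \<open>m\<close>: in the recurrence the first term sums by the binomial
  theorem and the second by its derivative. The difference in a ring keeps the formula valid at
  \<open>n = 0\<close>.\<close>

lemma card_parking_functions:
  assumes "n \<le> Suc m"
  shows "(of_nat (card (parking_functions n m)) :: 'a::comm_ring_1)
    = of_nat (Suc m) ^ n - of_nat n * of_nat (Suc m) ^ (n - 1)"
  using assms
proof (induction m arbitrary: n)
  case 0
  then consider "n = 0" | "n = Suc 0" by linarith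
  then show ?case
  proof cases
    case 1
    have "parking_functions 0 0 = {[]}" by (auto simp: parking_functions_def)
    then show ?thesis by (simp add: 1)
  next
    case 2
    show ?thesis unfolding 2 card_parking_functions_too_many by simp
  qed
next
  case (Suc m)
  show ?case
  proof (cases "n = Suc (Suc m)")
    case True
    then show ?thesis by (simp add: card_parking_functions_too_many)
  next
    case False
    then have n: "n \<le> Suc m" using Suc.prems by simp
    let ?x = "of_nat (Suc m) :: 'a"
    have "(of_nat (card (parking_functions n (Suc m))) :: 'a)
        = (\<Sum>j\<le>n. of_nat (n choose j) * (?x ^ j - of_nat j * ?x ^ (j - 1)))"
      unfolding card_parking_functions_Suc[OF n] of_nat_sum of_nat_mult
      using n by (intro sum.cong refl) (simp add: Suc.IH del: of_nat_Suc)
    also have "\<dots> = (?x + 1) ^ n - (\<Sum>j\<le>n. of_nat (n choose j) * of_nat j * ?x ^ (j - 1))"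
      unfolding binomial_ring by (simp add: sum_subtractf algebra_simps del: of_nat_Suc)
    finally show ?thesis unfolding binomial_derivative_sum by (simp add: add_ac)
  qed
qed

section \<open>Prescribed first preference\<close>

definition first_pref :: "nat \<Rightarrow> nat \<Rightarrow> nat \<Rightarrow> nat list set" where
  "first_pref r n m = {bs. r # bs \<in> shifted_pf 0 n m}"

lemma pf_count_eq: "pf_count r n m m = card (first_pref r n m)"
proof -
  have "{as \<in> parking_functions n m. (\<forall>a\<in>set as. a \<le> m) \<and> as \<noteq> [] \<and> hd as = r}
      = (#) r ` first_pref r n m"
    unfolding parking_functions_eq first_pref_def
    by (auto simp: neq_Nil_conv image_iff) (fastforce simp: shifted_pf_def)+
  then show ?thesis by (simp add: pf_count_def card_image)
qed

lemma first_pref_iff: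
  "bs \<in> first_pref r (Suc n) m \<longleftrightarrow> 0 < r \<and> r \<le> m \<and> length bs = n \<and> set bs \<subseteq> {0<..m} \<and>
    (\<forall>s\<in>{0<..m}. length (filter ((\<le>) s) bs) + (if s \<le> r then 1 else 0) + s \<le> Suc m)"
proof -
  have "length (filter ((\<le>) s) (r # bs)) = length (filter ((\<le>) s) bs) + (if s \<le> r then 1 else 0)" for s
    by simp
  then show ?thesis unfolding first_pref_def shifted_pf_def mem_Collect_eq
    by (simp del: filter.simps) blast
qed

lemma finite_first_pref: "finite (first_pref r n m)"
proof -
  have "(#) r ` first_pref r n m \<subseteq> shifted_pf 0 n m" by (auto simp: first_pref_def)
  then have "finite ((#) r ` first_pref r n m)" using finite_shifted_pf finite_subset by blast
  then show ?thesis by (rule finite_imageD) simp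
qed

text \<open>The two first preferences impose different conditions only at the threshold
  \<open>Suc (Suc r)\<close>. It fails for the larger one exactly when \<open>l\<close> other cars
  prefer the last \<open>l\<close> spaces; the first car then takes space \<open>Suc r\<close>, and
  the others must park below it.\<close>

lemma first_pref_Diff:
  assumes "l \<le> n"
  shows "first_pref (Suc r) (Suc n) (Suc r + l) - first_pref (Suc (Suc r)) (Suc n) (Suc r + l)
    = {bs. filter (\<lambda>x. x \<le> Suc r) bs \<in> shifted_pf 0 (n - l) r \<and>
        filter (\<lambda>x. \<not> x \<le> Suc r) bs \<in> shifted_pf (Suc r) l l}" (is "?A - ?B = ?Z")
proof (intro equalityI subsetI)
  let ?c = "\<lambda>s bs. length (filter ((\<le>) s) bs)"
  fix bs assume "bs \<in> ?A - ?B"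
  then have A: "bs \<in> ?A" and B: "bs \<notin> ?B" by auto
  let ?lo = "filter (\<lambda>x. x \<le> Suc r) bs" and ?hi = "filter (\<lambda>x. \<not> x \<le> Suc r) bs"
  from A have len: "length bs = n" and sub: "set bs \<subseteq> {0<..Suc r + l}"
    and cond: "\<And>s. 0 < s \<Longrightarrow> s \<le> Suc r + l \<Longrightarrow>
      ?c s bs + (if s \<le> Suc r then 1 else 0) + s \<le> Suc (Suc r + l)"
    by (auto simp: first_pref_iff)
  have hi: "?c s bs = ?c s ?hi" if "Suc r < s" for s
    using that by (simp only: filter_ge_filter_gt)
  have lo: "?c s bs = ?c s ?lo + length ?hi" if "s \<le> Suc r" for s
    using that by (rule length_filter_ge_split)
  have hi_all: "?c (Suc (Suc r)) bs = length ?hi"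
    by (intro arg_cong[where f = length] filter_cong) auto
  have len_hi: "length ?hi = l"
  proof (cases l)
    \<comment> \<open>Here \<open>Suc (Suc r)\<close> lies beyond the last space, so no violated
      threshold is available; the upper part is empty because no entry can exceed
      \<open>Suc r\<close>.\<close>
    case 0
    then have "?hi = []" using sub by (auto simp: filter_empty_conv)
    then show ?thesis using 0 by simp
  next
    case (Suc k)
    from B obtain s where s: "0 < s" "s \<le> Suc r + l"
      and viol: "\<not> ?c s bs + (if s \<le> Suc (Suc r) then 1 else 0) + s \<le> Suc (Suc r + l)"
      using len sub Suc by (auto simp: first_pref_iff)
    have "s = Suc (Suc r)" using cond[OF s] viol by (auto split: if_splits)
    then have "?c (Suc (Suc r)) bs \<ge> l" using viol by simp
    moreover have "?c (Suc (Suc r)) bs \<le> l" using cond[of "Suc (Suc r)"] Suc by simp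
    ultimately show ?thesis using hi_all by simp
  qed
  have len_lo: "length ?lo = n - l"
    using length_filter_split[of bs "\<lambda>x. x \<le> Suc r"] len len_hi by simp
  \<comment> \<open>The first car and the \<open>l\<close> upper cars exhaust the bound at
    \<open>Suc r\<close>, so no other car prefers that space.\<close>
  have "?c (Suc r) ?lo = 0" using cond[of "Suc r"] lo[of "Suc r"] len_hi by simp
  then have "x \<noteq> Suc r" if "x \<in> set bs" for x using that by (auto simp: filter_empty_conv)
  then have "set ?lo \<subseteq> {0<..r}" using sub by (fastforce simp: le_Suc_eq)
  moreover have "?c s ?lo + s \<le> Suc r" if "0 < s" "s \<le> r" for s
    using cond[of s] lo[of s] len_hi that by simp
  ultimately have "?lo \<in> shifted_pf 0 (n - l) r" using len_lo by (auto simp: shifted_pf_def)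
  moreover have "?c s ?hi + s \<le> Suc (Suc r + l)" if "Suc r < s" "s \<le> Suc r + l" for s
    using cond[of s] hi[of s] that by simp
  then have "?hi \<in> shifted_pf (Suc r) l l" using len_hi sub by (auto simp: shifted_pf_def)
  ultimately show "bs \<in> ?Z" by simp
next
  let ?c = "\<lambda>s bs. length (filter ((\<le>) s) bs)"
  fix bs assume "bs \<in> ?Z"
  let ?lo = "filter (\<lambda>x. x \<le> Suc r) bs" and ?hi = "filter (\<lambda>x. \<not> x \<le> Suc r) bs"
  from \<open>bs \<in> ?Z\<close> have L: "?lo \<in> shifted_pf 0 (n - l) r" and H: "?hi \<in> shifted_pf (Suc r) l l" by auto
  have len: "length bs = n"
    using length_filter_split[of bs "\<lambda>x. x \<le> Suc r"] L H assms by (simp add: shifted_pf_def)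
  have len_hi: "length ?hi = l" using H by (simp add: shifted_pf_def)
  have hi: "?c s bs = ?c s ?hi" if "Suc r < s" for s
    using that by (simp only: filter_ge_filter_gt)
  have lo: "?c s bs = ?c s ?lo + length ?hi" if "s \<le> Suc r" for s
    using that by (rule length_filter_ge_split)
  have hi_all: "?c (Suc (Suc r)) bs = length ?hi"
    by (intro arg_cong[where f = length] filter_cong) auto
  have lo_sub: "set ?lo \<subseteq> {0<..r}" and hi_sub: "set ?hi \<subseteq> {Suc r<..Suc r + l}"
    using L H by (auto simp: shifted_pf_def)
  have "set bs = set ?lo \<union> set ?hi" by auto
  then have sub: "set bs \<subseteq> {0<..Suc r + l}" using lo_sub hi_sub by fastforce
  have "?c s bs + (if s \<le> Suc r then 1 else 0) + s \<le> Suc (Suc r + l)"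
    if s: "0 < s" "s \<le> Suc r + l" for s
  proof -
    consider "s \<le> r" | "s = Suc r" | "Suc r < s" by linarith
    then show ?thesis
    proof cases
      case 1
      then have "?c s ?lo + s \<le> Suc r" using L s by (auto simp: shifted_pf_def)
      then show ?thesis using 1 lo[of s] len_hi by simp
    next
      case 2
      have "filter ((\<le>) (Suc r)) ?lo = []" using lo_sub by (auto simp: filter_empty_conv)
      then show ?thesis using 2 lo[of s] len_hi by simp
    next
      case 3
      then have "?c s ?hi + s \<le> Suc (Suc r + l)" using H s by (auto simp: shifted_pf_def)
      then show ?thesis using 3 hi[of s] by simp
    qed
  qed
  then have "bs \<in> ?A" using len sub by (auto simp: first_pref_iff)
  moreover have "bs \<notin> ?B"
  proof
    assume B: "bs \<in> ?B"
    \<comment> \<open>The first preference must be an actual space, so the threshold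
      \<open>Suc (Suc r)\<close> applies; there the first car joins \<open>l\<close> others on
      \<open>l\<close> spaces.\<close>
    then have "Suc (Suc r) \<in> {0<..Suc r + l}" by (simp add: first_pref_iff)
    with B have "?c (Suc (Suc r)) bs + 1 + Suc (Suc r) \<le> Suc (Suc r + l)"
      unfolding first_pref_iff by fastforce
    then show False using hi_all len_hi by simp
  qed
  ultimately show "bs \<in> ?A - ?B" by simp
qed

lemma pf_count_diff:
  assumes "l \<le> n"
  shows "pf_count (Suc r) (Suc n) (Suc r + l) (Suc r + l)
    = pf_count (Suc (Suc r)) (Suc n) (Suc r + l) (Suc r + l)
      + (n choose l) * pf_number l * card (parking_functions (n - l) r)"
proof -
  let ?A = "first_pref (Suc r) (Suc n) (Suc r + l)" and ?B = "first_pref (Suc (Suc r)) (Suc n) (Suc r + l)"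
  have "?B \<subseteq> ?A"
  proof
    fix bs assume B: "bs \<in> ?B"
    have "length (filter ((\<le>) s) bs) + (if s \<le> Suc r then 1 else 0) + s \<le> Suc (Suc r + l)"
      if "s \<in> {0<..Suc r + l}" for s
    proof -
      have "length (filter ((\<le>) s) bs) + (if s \<le> Suc (Suc r) then 1 else 0) + s \<le> Suc (Suc r + l)"
        using B that unfolding first_pref_iff by blast
      then show ?thesis by (auto split: if_splits)
    qed
    then show "bs \<in> ?A" using B unfolding first_pref_iff by simp
  qed
  then have "card ?A = card ?B + card (?A - ?B)"
    using finite_first_pref by (metis card_Diff_subset card_mono le_add_diff_inverse)
  also have "card (?A - ?B) = ((n - l + l) choose (n - l)) * card (shifted_pf 0 (n - l) r)
      * card (shifted_pf (Suc r) l l)"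
    unfolding first_pref_Diff[OF assms]
    by (intro card_filter_partition(2) finite_shifted_pf) (fastforce simp: shifted_pf_def)+
  finally show ?thesis
    using assms by (simp add: pf_count_eq card_shifted_pf pf_number_def binomial_symmetric[of l n] mult_ac)
qed

lemma pf_count_outside: "m < r \<Longrightarrow> pf_count r (Suc n) m m = 0"
  by (simp add: pf_count_eq first_pref_iff card_eq_0_iff set_eq_iff)

text \<open>Thresholds up to \<open>Suc k\<close> hold even if all \<open>Suc n\<close> cars are
  counted, so both first preferences face the same conditions. This gives the correction term of
  degree \<open>l\<close> in the recurrence.\<close>

lemma pf_count_small_pref:
  "pf_count (Suc k) (Suc n) (Suc n + k) (Suc n + k)
    = pf_count 1 (Suc n) (Suc n + k) (Suc n + k)"
proof -
  have "length (filter ((\<le>) s) bs) + 1 + s \<le> Suc (Suc n + k)"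
    if "length bs = n" "s \<le> Suc k" for s and bs :: "nat list"
    using length_filter_le[of "(\<le>) s" bs] that by linarith
  then have "length (filter ((\<le>) s) bs) + (if s \<le> Suc k then 1 else 0) + s \<le> Suc (Suc n + k) \<longleftrightarrow>
      length (filter ((\<le>) s) bs) + (if s \<le> 1 then 1 else 0) + s \<le> Suc (Suc n + k)"
    if "length bs = n" for s and bs :: "nat list"
    using that by (cases "s \<le> Suc k") fastforce+
  then have "first_pref (Suc k) (Suc n) (Suc n + k) = first_pref 1 (Suc n) (Suc n + k)"
    by (intro set_eqI) (simp add: first_pref_iff cong: conj_cong)
  then show ?thesis by (simp add: pf_count_eq)
qed

section \<open>Coefficients of the recurrence for \<open>H_series\<close>\<close>

lemma P_series_power_nth:
  "(P_series ^ Suc k) $ j = of_nat (card (parking_functions j (j + k))) / fact j"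
proof -
  \<comment> \<open>With \<open>m = j + k\<close> the base \<open>Suc m\<close> of the closed form
    is \<open>Suc k + j\<close>.\<close>
  have "of_nat (card (parking_functions j (j + k))) = (abel_coeff (of_nat (Suc k)) j :: rat)"
    by (subst card_parking_functions) (simp_all add: abel_coeff_def add_ac)
  then show ?thesis unfolding P_series_power by (simp add: abel_fps_def del: of_nat_Suc)
qed

text \<open>After division by \<open>fact n\<close> the binomial coefficient splits into
  \<open>1 / fact l\<close> and \<open>1 / fact (n - l)\<close>, the normalizations of the two
  blocks.\<close>

lemma pf_count_diff_series:
  assumes "l \<le> n"
  shows "(of_nat (pf_count (Suc n + k - l) (Suc n) (Suc n + k) (Suc n + k)) / fact n :: rat)
    = of_nat (pf_count (Suc (Suc n + k - l)) (Suc n) (Suc n + k) (Suc n + k)) / fact n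
      + of_nat (pf_number l) / fact l * (P_series ^ Suc k) $ (n - l)"
proof -
  \<comment> \<open>The lower block has \<open>n - l\<close> cars and \<open>k\<close> spaces more
    than cars, whence the exponent \<open>Suc k\<close>.\<close>
  define r where "r = n - l + k"
  have r: "Suc n + k = Suc r + l" using assms by (simp add: r_def)
  have "of_nat (n choose l) / fact n = (1 / (fact l * fact (n - l)) :: rat)"
    using assms by (simp add: binomial_fact)
  then have "of_nat ((n choose l) * pf_number l * card (parking_functions (n - l) r)) / fact n
      = of_nat (pf_number l) / fact l * (P_series ^ Suc k) $ (n - l)"
    unfolding P_series_power_nth r_def using assms by (simp add: field_simps)
  then show ?thesis
    unfolding r diff_add_inverse2 by (simp only: pf_count_diff[OF assms, of r] of_nat_add add_divide_distrib)
qed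

theorem theorem7p2:
  fixes k :: nat
  shows "H_series 0 k = fps_X * P_series ^ (k + 1) \<and>
    (\<forall>l\<ge>1. H_series l k =
       H_series (l - 1) k
       - fps_const (of_nat (pf_count 1 l (l + k) (l + k)) / fact (l - 1)) * fps_X ^ l
       + fps_const (of_nat (pf_number l) / fact l) * fps_X ^ (l + 1) * P_series ^ (k + 1))"
proof (intro conjI allI impI)
  show "H_series 0 k = fps_X * P_series ^ (k + 1)"
  proof (rule fps_ext)
    fix n
    show "H_series 0 k $ n = (fps_X * P_series ^ (k + 1)) $ n"
    proof (cases n)
      case (Suc N)
      \<comment> \<open>For \<open>l = 0\<close> the difference formula compares with a first
        preference beyond the last space, whose count is 0.\<close>
      have "pf_number 0 = 1"
        using card_parking_functions[of 0 0, where 'a = int] by (simp add: pf_number_def)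
      then show ?thesis
        using pf_count_diff_series[of 0 N k] pf_count_outside[of "Suc N + k" "Suc (Suc N + k)" N]
        by (simp add: Suc H_series_def)
    qed (simp add: H_series_def)
  qed
next
  fix l :: nat
  assume "1 \<le> l"
  then obtain j where l: "l = Suc j" by (cases l) auto
  let ?c = "of_nat (pf_count 1 l (l + k) (l + k)) / fact (l - 1) :: rat"
  let ?d = "of_nat (pf_number l) / fact l :: rat"
  show "H_series l k = H_series (l - 1) k - fps_const ?c * fps_X ^ l
      + fps_const ?d * fps_X ^ (l + 1) * P_series ^ (k + 1)"
  proof (rule fps_ext)
    fix n
    have rhs: "(H_series (l - 1) k - fps_const ?c * fps_X ^ l
        + fps_const ?d * fps_X ^ (l + 1) * P_series ^ (k + 1)) $ n
      = H_series (l - 1) k $ n - (if n = l then ?c else 0)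
        + (if n \<le> l then 0 else ?d * (P_series ^ Suc k) $ (n - Suc l))"
      by (simp add: mult.assoc fps_X_power_mult_nth del: power_Suc fact_Suc)
    consider "n < l" | "n = l" | "l < n" by linarith
    then have "H_series l k $ n = H_series (l - 1) k $ n - (if n = l then ?c else 0)
        + (if n \<le> l then 0 else ?d * (P_series ^ Suc k) $ (n - Suc l))"
    proof cases
      case 1
      then show ?thesis by (auto simp: H_series_def)
    next
      case 2
      \<comment> \<open>\<open>H_series l k\<close> starts only in degree \<open>l + 1\<close>. The
        coefficient of \<open>H_series (l - 1) k\<close> in degree \<open>l\<close> has first
        preference \<open>Suc k\<close>, and the correction term cancels it.\<close>
      then show ?thesis using pf_count_small_pref[of k j] by (simp add: H_series_def l)
    next
      case 3
      then obtain N where N: "n = Suc N" "l \<le> N" by (cases n) auto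
      \<comment> \<open>Passing from \<open>l\<close> to \<open>l - 1\<close> raises the first
        preference by one, as the difference formula requires.\<close>
      have "Suc (Suc N + k - l) = Suc N + k - (l - 1)" using N l by simp
      then show ?thesis
        using 3 pf_count_diff_series[OF N(2), of k] by (simp add: H_series_def N(1) l del: power_Suc fact_Suc)
    qed
    then show "H_series l k $ n = (H_series (l - 1) k - fps_const ?c * fps_X ^ l
        + fps_const ?d * fps_X ^ (l + 1) * P_series ^ (k + 1)) $ n"
      unfolding rhs .
  qed
qed

end
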